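(* In the setting described in the context, assume that for every $m\ge1$, every $x\in\mathcal X^{\mathbb N}$ and all $y,y'\in\mathcal Y$, $d(F_m(x;y),F_m(x;y'))\le\delta(y,y')$, and that there exist positive constants $V_k$ such that $\mathbb E[(G_{\varepsilon_k}(\varepsilon_k))^2]\le V_k$ for every $k\in[1,n]$. Let $$V=\sum_{k=1}^n\big(a_{n-k}(n-k)\big)^2V_k.$$ Then, for either choice of sign and all $x,y>0$, $$\mathbb P(\pm S_n\ge x)\le H_n\Big(\frac{x}{y\,a_{n-1}(n-1)},\frac{\sqrt V}{y\,a_{n-1}(n-1)}\Big)+\mathbb P\Big(\max_{1\le k\le n}G_{\varepsilon_k}(\varepsilon_k)>y\Big),$$ where $$H_n(x,v)=\Big\{\Big(\frac{v^2}{x+v^2}\Big)^{x+v^2}\Big(\frac{n}{n-x}\Big)^{n-x}\Big\}^{\frac{n}{n+v^2}}\mathbf 1_{\{x\le n\}}$$ with the convention $(+\infty)^0=1$ (which applies when $x=n$).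
   Context: Let $(\mathcal X,d)$ and $(\mathcal Y,\delta)$ be complete separable metric spaces. Let $(\varepsilon_i)_{i\ge1}$ be independent (not necessarily identically distributed) $\mathcal Y$-valued random variables, with $P_{\varepsilon_k}$ the law of $\varepsilon_k$. Let $(X_i)_{i\le0}$ be a deterministic sequence in $\mathcal X$. For each $m\ge1$ let $F_m:\mathcal X^{\mathbb N}\times\mathcal Y\to\mathcal X$ be measurable, and define recursively $X_m=F_m((X_{m-i})_{i\ge1};\varepsilon_m)$ for $m\ge1$. Assume there are nonnegative numbers $a_i$, $i\ge1$, with $\sum_{i\ge1}a_i<1$, such that for all $m\ge1$ and all sequences $(x_{m-i})_{i\ge1},(x'_{m-i})_{i\ge1}$ in $\mathcal X$, $$\mathbb E\big[d\big(F_m((x_{m-i})_{i\ge1};\varepsilon_m),F_m((x'_{m-i})_{i\ge1};\varepsilon_m)\big)\big]\le\sum_{i=1}^\infty a_i\,d(x_{m-i},x'_{m-i}).$$ Fix $n\ge1$ and let $f:\mathcal X^n\to\mathbb R$ satisfy $|f(x_1,\ldots,x_n)-f(x'_1,\ldots,x'_n)|\le\sum_{i=1}^n d(x_i,x'_i)$. Put $S_n=f(X_1,\ldots,X_n)-\mathbb E[f(X_1,\ldots,X_n)]$. The numbers $a_k(k)$, $k\ge0$, are defined recursively by $a_0(0)=1$ and $a_k(k)=1+a_k+\sum_{l=1}^{k-1}a_l(l)\,a_{k-l}$ for $k\ge1$ (so $a_1(1)=1+a_1$). $G_{\varepsilon_k}(y)=\int\delta(y,y')\,P_{\varepsilon_k}(dy')$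 for $y\in\mathcal Y$. *)

theory Defs
  imports "HOL-Probability.Probability"
begin

text \<open>The numbers \<open>a\<^sub>k(k)\<close>; the entry \<open>a 0\<close> of the sequence \<open>a\<close> is never used.\<close>

function diag_coeff :: "(nat \<Rightarrow> real) \<Rightarrow> nat \<Rightarrow> real" where
  "diag_coeff a k =
     (if k = 0 then 1 else 1 + a k + (\<Sum>l\<in>{1..<k}. diag_coeff a l * a (k - l)))"
  by pat_completeness auto
termination by (relation "Wellfounded.measure snd") auto

declare diag_coeff.simps [simp del]

text \<open>\<open>G\<^sub>\<epsilon>(y)\<close> with \<open>P\<close> the law of \<open>\<epsilon>\<close>, taken in \<open>[0,\<infinity>]\<close> since the mean distance is not assumed finite.\<close>

definition G_fun :: "'y::metric_space measure \<Rightarrow> 'y \<Rightarrow> ennreal" where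
  "G_fun P y = (\<integral>\<^sup>+ y'. ennreal (dist y y') \<partial>P)"

text \<open>The case \<open>x = n\<close> is separate because of the convention \<open>(+\<infinity>)\<^sup>0 = 1\<close>:
  in HOL, \<open>n / 0 = 0\<close> and \<open>0 powr 0 = 0\<close>.\<close>

definition H_fun :: "nat \<Rightarrow> real \<Rightarrow> real \<Rightarrow> real" where
  "H_fun n x v =
     ((v\<^sup>2 / (x + v\<^sup>2)) powr (x + v\<^sup>2) *
      (if x = real n then 1 else (real n / (real n - x)) powr (real n - x)))
       powr (real n / (real n + v\<^sup>2)) * (if x \<le> real n then 1 else 0)"

end

theory Submission
  imports Defs "HOL-Real_Asymp.Real_Asymp"
begin

text \<open>
  Let \<open>g\<^sub>k\<close> be the conditional expectation of \<open>f (X\<^sub>1, \<dots>, X\<^sub>n)\<close> given the first \<open>k\<close> values. By backward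
  induction, the contraction assumption makes \<open>g\<^sub>k\<close> Lipschitz in its last coordinate with constant
  \<open>a\<^sub>n\<^sub>-\<^sub>k(n-k)\<close>, so the increment of the martingale \<open>g\<^sub>k\<close> is at most \<open>a\<^sub>n\<^sub>-\<^sub>k(n-k) G(\<epsilon>\<^sub>k)\<close>. On the event
  that all \<open>G(\<epsilon>\<^sub>k)\<close> are at most \<open>y\<close>, the rescaled increments are at most \<open>1\<close>, and Bennett's
  bound on the Laplace transform of such a variable, with variance \<open>t\<close>, is
  \<open>(e\<^sup>-\<^sup>l\<^sup>t + t e\<^sup>l) / (1 + t)\<close>. This is concave in \<open>t\<close>, so the product over \<open>k\<close> is largest for
  equal variances; optimising over \<open>l\<close> gives \<open>H\<^sub>n\<close>.
\<close>

subsection \<open>Bennett's bound and its optimisation\<close>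

text \<open>The ratio \<open>(exp u - 1 - u) / u\<^sup>2\<close> is nondecreasing, with limit 1/2 at
  0. For \<open>u \<ge> 0\<close> the Taylor tails are compared term by term; for
  \<open>u < 0\<close> the constant 1/2 separates the two sides.\<close>

lemma exp_le_quadratic:
  fixes u w :: real
  assumes "u \<le> w" "w > 0"
  shows "exp u \<le> 1 + u + (exp w - 1 - w) / w\<^sup>2 * u\<^sup>2"
proof (cases "u \<ge> 0")
  case True
  have summ: "summable (\<lambda>n. inverse (fact (n + 2)) * x ^ (n + 2))" for x :: real
    using summable_exp_generic[of x] by (subst summable_iff_shift) simp
  have tail: "exp x - 1 - x = (\<Sum>n. inverse (fact (n + 2)) * x ^ (n + 2))" for x :: real
    using exp_first_two_terms[of x] by simp
  have "w\<^sup>2 * (exp u - 1 - u) = (\<Sum>n. w\<^sup>2 * (inverse (fact (n + 2)) * u ^ (n + 2)))"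
    unfolding tail by (rule suminf_mult[symmetric, OF summ])
  also have "\<dots> \<le> (\<Sum>n. u\<^sup>2 * (inverse (fact (n + 2)) * w ^ (n + 2)))"
  proof (intro suminf_le summable_mult summ)
    fix n
    define c :: real where "c = inverse (fact (n + 2))"
    have "u ^ n \<le> w ^ n" using True assms by (intro power_mono)
    then have "(w\<^sup>2 * c * u\<^sup>2) * u ^ n \<le> (w\<^sup>2 * c * u\<^sup>2) * w ^ n"
      by (intro mult_left_mono) (auto simp: c_def)
    then show "w\<^sup>2 * (inverse (fact (n + 2)) * u ^ (n + 2)) \<le> u\<^sup>2 * (inverse (fact (n + 2)) * w ^ (n + 2))"
      unfolding c_def[symmetric] by (simp only: power_add mult_ac)
  qed
  also have "\<dots> = u\<^sup>2 * (exp w - 1 - w)"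
    unfolding tail by (rule suminf_mult[OF summ])
  finally have "exp u - 1 - u \<le> u\<^sup>2 * (exp w - 1 - w) / w\<^sup>2"
    using assms by (simp add: pos_le_divide_eq mult_ac)
  then show ?thesis by (simp add: mult_ac)
next
  case False
  \<comment> \<open>The quadratic Taylor polynomials at \<open>u\<close> and \<open>- u\<close>
    multiply to \<open>1 + u ^ 4 / 4\<close>.\<close>
  have "1 \<le> (1 + u\<^sup>2 / 2)\<^sup>2 - u\<^sup>2"
    by (simp add: power2_sum power_divide)
  also have "\<dots> = (1 + - u + (- u)\<^sup>2 / 2) * (1 + u + u\<^sup>2 / 2)"
    by (simp add: algebra_simps power2_eq_square)
  also have "\<dots> \<le> exp (- u) * (1 + u + u\<^sup>2 / 2)"
  proof (intro mult_right_mono exp_lower_Taylor_quadratic)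
    have "1 + u + u\<^sup>2 / 2 = ((1 + u)\<^sup>2 + 1) / 2" by (simp add: power2_eq_square field_simps)
    also have "\<dots> \<ge> 0" by simp
    finally show "1 + u + u\<^sup>2 / 2 \<ge> 0" .
  qed (use False in simp)
  finally have "exp u \<le> 1 + u + 1 / 2 * u\<^sup>2" by (simp add: exp_minus field_simps)
  moreover have "1 / 2 \<le> (exp w - 1 - w) / w\<^sup>2"
    using exp_lower_Taylor_quadratic[of w] assms by (simp add: field_simps)
  then have "1 / 2 * u\<^sup>2 \<le> (exp w - 1 - w) / w\<^sup>2 * u\<^sup>2" by (intro mult_right_mono) auto
  ultimately show ?thesis by linarith
qed

text \<open>The Laplace transform at \<open>l\<close> of the centred law on \<open>{- t, 1}\<close>, whose variance is \<open>t\<close>.\<close>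
definition two_point_mgf :: "real \<Rightarrow> real \<Rightarrow> real" where
  "two_point_mgf l t = (exp (- l * t) + t * exp l) / (1 + t)"

lemma two_point_mgf_nonneg: "t \<ge> 0 \<Longrightarrow> two_point_mgf l t \<ge> 0"
  by (simp add: two_point_mgf_def)

text \<open>In this form \<open>t\<close> enters only through \<open>(1 - exp (- l * r)) / r\<close>
  at \<open>r = 1 + t\<close>; convexity of that function makes the transform concave in
  \<open>t\<close>.\<close>

lemma two_point_mgf_eq:
  assumes "t \<ge> 0"
  shows "two_point_mgf l t = exp l * (1 - (1 - exp (- l * (1 + t))) / (1 + t))"
proof -
  have "exp l * exp (- l * (1 + t)) = exp (- l * t)"
    by (simp flip: exp_add add: algebra_simps)
  then show ?thesis using assms by (simp add: two_point_mgf_def field_simps)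
qed

text \<open>The quadratic majorant of the exponential touches it at \<open>- t\<close> and meets it at \<open>1\<close>.\<close>
lemma (in prob_space) truncated_mgf_le:
  fixes \<xi> :: "'a \<Rightarrow> real"
  assumes int: "integrable M \<xi>" "integrable M (\<lambda>w. (\<xi> w)\<^sup>2)"
    and mean: "expectation \<xi> = 0" and var: "expectation (\<lambda>w. (\<xi> w)\<^sup>2) \<le> t"
    and A: "A \<in> events" "\<And>w. w \<in> A \<Longrightarrow> \<xi> w \<le> 1"
    and l: "l > 0" and t: "t > 0"
  shows "(\<integral>\<^sup>+ w. ennreal (exp (l * \<xi> w)) * indicator A w \<partial>M) \<le> ennreal (two_point_mgf l t)"
proof -
  \<comment> \<open>The value of \<open>\<gamma>\<close> is dictated by
    \<open>q 1 = exp l\<close>.\<close>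
  define \<gamma> where "\<gamma> = (exp l - exp (- l * t) * (1 + l * (1 + t))) / (1 + t)\<^sup>2"
  define q where "q x = exp (- l * t) * (1 + l * (x + t)) + \<gamma> * (x + t)\<^sup>2" for x
  \<comment> \<open>The same constant as produced by \<open>exp_le_quadratic\<close> with
    \<open>u = l * (x + t)\<close> and \<open>w = l * (1 + t)\<close>.\<close>
  have gamma: "\<gamma> = exp (- l * t) * l\<^sup>2 * ((exp (l * (1 + t)) - 1 - l * (1 + t)) / (l * (1 + t))\<^sup>2)"
  proof -
    have "exp (- l * t) * exp (l * (1 + t)) = exp l"
      by (simp flip: exp_add add: algebra_simps)
    then have "exp (- l * t) * (exp (l * (1 + t)) - 1 - l * (1 + t)) = exp l - exp (- l * t) * (1 + l * (1 + t))"
      by (simp only: right_diff_distrib distrib_left mult_1_right diff_diff_eq)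
    then show ?thesis using l by (simp add: \<gamma>_def power_mult_distrib)
  qed
  have gamma0: "\<gamma> \<ge> 0"
  proof -
    have "exp (l * (1 + t)) - 1 - l * (1 + t) \<ge> 0"
      using exp_ge_add_one_self[of "l * (1 + t)"] by linarith
    then show ?thesis unfolding gamma by (intro mult_nonneg_nonneg divide_nonneg_nonneg) auto
  qed
  have q_ge: "exp (l * x) \<le> q x" if "x \<le> 1" for x
  proof -
    have "exp (l * x) = exp (- l * t) * exp (l * (x + t))"
      by (simp flip: exp_add add: algebra_simps)
    also have "\<dots> \<le> exp (- l * t) * (1 + l * (x + t) + (exp (l * (1 + t)) - 1 - l * (1 + t)) / (l * (1 + t))\<^sup>2 * (l * (x + t))\<^sup>2)"
      using l t that by (intro mult_left_mono exp_le_quadratic) auto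
    also have "\<dots> = q x" unfolding q_def gamma power_mult_distrib by (simp add: algebra_simps)
    finally show ?thesis .
  qed
  \<comment> \<open>Nonnegativity also for \<open>x > 1\<close> allows the indicator of
    \<open>A\<close> to be dropped once the exponential is replaced by \<open>q\<close>.\<close>
  have q0: "q x \<ge> 0" for x
  proof (cases "x \<le> 1")
    case True then show ?thesis using q_ge[of x] exp_ge_zero[of "l * x"] by linarith
  next
    case False then show ?thesis using l t gamma0 by (auto simp: q_def intro!: add_nonneg_nonneg)
  qed
  have q_eq: "q x = (exp (- l * t) * (1 + l * t) + \<gamma> * t\<^sup>2) + (exp (- l * t) * l + 2 * \<gamma> * t) * x + \<gamma> * x\<^sup>2" for x
    by (simp add: q_def algebra_simps power2_eq_square)
  have "(\<integral>\<^sup>+ w. ennreal (exp (l * \<xi> w)) * indicator A w \<partial>M) \<le> (\<integral>\<^sup>+ w. ennreal (q (\<xi> w)) \<partial>M)"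
    using A q0 q_ge by (intro nn_integral_mono) (auto simp: indicator_def intro!: ennreal_leI)
  also have "\<dots> = ennreal (expectation (\<lambda>w. q (\<xi> w)))"
  proof (rule nn_integral_eq_integral)
    show "integrable M (\<lambda>w. q (\<xi> w))"
      unfolding q_eq by (intro Bochner_Integration.integrable_add Bochner_Integration.integrable_mult_right int) simp_all
  qed (simp add: q0)
  also have "expectation (\<lambda>w. q (\<xi> w)) = (exp (- l * t) * (1 + l * t) + \<gamma> * t\<^sup>2) + \<gamma> * expectation (\<lambda>w. (\<xi> w)\<^sup>2)"
    unfolding q_eq using int mean by (simp add: prob_space)
  \<comment> \<open>The linear term has vanished with the mean, and \<open>\<gamma> \<ge> 0\<close>
    lets the second moment be replaced by \<open>t\<close>.\<close>
  also have "\<dots> \<le> (exp (- l * t) * (1 + l * t) + \<gamma> * t\<^sup>2) + \<gamma> * t"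
    using var gamma0 by (intro add_left_mono mult_left_mono)
  also have "\<dots> = exp (- l * t) * (1 + l * t) + \<gamma> * (1 + t)\<^sup>2 * (t / (1 + t))"
    using t by (simp add: field_simps power2_eq_square)
  also have "\<gamma> * (1 + t)\<^sup>2 = exp l - exp (- l * t) * (1 + l * (1 + t))"
    using t by (simp add: \<gamma>_def)
  also have "exp (- l * t) * (1 + l * t) + (exp l - exp (- l * t) * (1 + l * (1 + t))) * (t / (1 + t)) = two_point_mgf l t"
    using t by (simp add: two_point_mgf_def field_simps)
  finally show ?thesis by (simp add: ennreal_leI)
qed

text \<open>The second derivative is nonnegative because
  \<open>1 + u + u\<^sup>2 / 2 \<le> exp u\<close> at \<open>u = l * s\<close>.\<close>

lemma convex_on_one_minus_exp_div:
  fixes l :: real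
  assumes "l \<ge> 0"
  shows "convex_on {0<..} (\<lambda>s. (1 - exp (- l * s)) / s)"
proof (rule f''_ge0_imp_convex)
  let ?f' = "\<lambda>s. (l * s * exp (- l * s) - (1 - exp (- l * s))) / s\<^sup>2"
  let ?f'' = "\<lambda>s. (2 - exp (- l * s) * (2 + 2 * (l * s) + (l * s)\<^sup>2)) / s ^ 3"
  fix s :: real assume "s \<in> {0<..}"
  then have s: "s > 0" by simp
  show "((\<lambda>s. (1 - exp (- l * s)) / s) has_real_derivative ?f' s) (at s)"
    using s by (auto intro!: derivative_eq_intros simp: power2_eq_square field_simps)
  show "(?f' has_real_derivative ?f'' s) (at s)"
    using s by (auto intro!: derivative_eq_intros simp: power2_eq_square power3_eq_cube divide_simps) (simp add: algebra_simps)
  have "2 * (1 + l * s + (l * s)\<^sup>2 / 2) \<le> 2 * exp (l * s)"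
    using assms s by (intro mult_left_mono exp_lower_Taylor_quadratic) auto
  then have "exp (- l * s) * (2 + 2 * (l * s) + (l * s)\<^sup>2) \<le> exp (- l * s) * (2 * exp (l * s))"
    by (intro mult_left_mono) (auto simp: algebra_simps)
  also have "\<dots> = 2" by (simp add: exp_minus)
  finally show "?f'' s \<ge> 0" using s by simp
qed simp

text \<open>The geometric mean of the factors is at most their arithmetic mean, which by Jensen's
  inequality and concavity is at most the value at the mean variance.\<close>

lemma prod_two_point_mgf_le:
  fixes t :: "nat \<Rightarrow> real"
  assumes l: "l > 0" and I: "finite I" "I \<noteq> {}" and t: "\<And>i. i \<in> I \<Longrightarrow> t i \<ge> 0"
  shows "(\<Prod>i\<in>I. two_point_mgf l (t i)) \<le> two_point_mgf l ((\<Sum>i\<in>I. t i) / card I) ^ card I"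
proof -
  define n where "n = real (card I)"
  have n: "n > 0" using I by (simp add: n_def card_gt_0_iff)
  let ?g = "\<lambda>s. (1 - exp (- l * s)) / s"
  have sum1: "(\<Sum>i\<in>I. 1 / n) = 1" using n by (simp add: n_def)
  have mean: "(\<Sum>i\<in>I. (1 / n) *\<^sub>R (1 + t i)) = 1 + (\<Sum>i\<in>I. t i) / n"
    using n by (simp add: sum.distrib n_def add_divide_distrib flip: sum_divide_distrib)
  have "?g (\<Sum>i\<in>I. (1 / n) *\<^sub>R (1 + t i)) \<le> (\<Sum>i\<in>I. 1 / n * ?g (1 + t i))"
    using t n l I sum1
    by (intro convex_on_sum[OF _ _ convex_on_one_minus_exp_div]) (auto intro!: add_pos_nonneg)
  then have "1 - (\<Sum>i\<in>I. 1 / n * ?g (1 + t i)) \<le> 1 - ?g (1 + (\<Sum>i\<in>I. t i) / n)"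
    unfolding mean by simp
  also have "1 - (\<Sum>i\<in>I. 1 / n * ?g (1 + t i)) = (\<Sum>i\<in>I. 1 / n * (1 - ?g (1 + t i)))"
    unfolding right_diff_distrib sum_subtractf using sum1 by simp
  finally have "exp l * (\<Sum>i\<in>I. 1 / n * (1 - ?g (1 + t i))) \<le> exp l * (1 - ?g (1 + (\<Sum>i\<in>I. t i) / n))"
    by (intro mult_left_mono) auto
  then have mean_le: "(\<Sum>i\<in>I. two_point_mgf l (t i) / n) \<le> two_point_mgf l ((\<Sum>i\<in>I. t i) / n)"
    using t n by (simp add: two_point_mgf_eq sum_nonneg sum_distrib_left mult_ac)
  have "(\<Prod>i\<in>I. two_point_mgf l (t i)) = ((\<Prod>i\<in>I. two_point_mgf l (t i)) powr (1 / n)) ^ card I"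
    using n by (cases "(\<Prod>i\<in>I. two_point_mgf l (t i)) = 0")
      (auto simp: n_def powr_power powr_one prod_nonneg two_point_mgf_nonneg t)
  also have "\<dots> \<le> (\<Sum>i\<in>I. two_point_mgf l (t i) / n) ^ card I"
    using I t unfolding n_def by (intro power_mono arith_geom_mean) (auto simp: two_point_mgf_nonneg)
  also have "\<dots> \<le> two_point_mgf l ((\<Sum>i\<in>I. t i) / n) ^ card I"
    using mean_le t n by (intro power_mono sum_nonneg) (auto simp: two_point_mgf_nonneg)
  finally show ?thesis by (simp add: n_def)
qed

text \<open>For \<open>x < n\<close> an explicit stationary \<open>l\<close> gives exactly
  \<open>H_fun n x v\<close>. For \<open>x \<ge> n\<close> the bound is obtained by letting
  \<open>l\<close> tend to infinity; the limit is 0 when \<open>x > n\<close>.\<close>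

lemma le_H_funI:
  fixes x v Q :: real
  assumes n: "n \<ge> 1" and x: "x > 0" and v: "v > 0"
    and Q: "\<And>l. l > 0 \<Longrightarrow> Q \<le> exp (- l * x) * two_point_mgf l (v\<^sup>2 / n) ^ n"
  shows "Q \<le> H_fun n x v"
proof -
  define t where "t = v\<^sup>2 / n"
  have t: "t > 0" and nt: "n * t = v\<^sup>2" using n v by (auto simp: t_def)
  show ?thesis
  proof (cases "x < n")
    case True
    define A where "A = ln (v\<^sup>2 / (x + v\<^sup>2))"
    define B where "B = ln (n / (n - x))"
    \<comment> \<open>The zero of the derivative of
      \<open>- l * x + n * ln (two_point_mgf l t)\<close> in \<open>l\<close>: it solves \<open>exp
      (l * (1 + t)) = n * (x + v\<^sup>2) / (v\<^sup>2 * (n - x))\<close>.\<close>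
    define l where "l = n / (n + v\<^sup>2) * (B - A)"
    have v2: "v\<^sup>2 > 0" using v by simp
    have nv: "n + v\<^sup>2 > 0" using n v2 by linarith
    have xv: "x + v\<^sup>2 > 0" using x v2 by linarith
    have "A < 0" unfolding A_def using x v2 xv
      by (intro ln_less_zero) (auto simp: divide_simps)
    moreover have "B > 0" using x True n by (auto simp: B_def intro!: ln_gt_zero)
    ultimately have l: "l > 0" using n nv by (auto simp: l_def intro!: mult_pos_pos divide_pos_pos)
    have l_eq: "l * (1 + t) = B - A"
    proof -
      have "1 + t = (n + v\<^sup>2) / n" using n by (simp add: t_def field_simps)
      then show ?thesis using n nv by (simp add: l_def)
    qed
    have exp_AB: "exp (B - A) = (n / (n - x)) * ((x + v\<^sup>2) / v\<^sup>2)"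
      using True x v2 n xv nv by (simp add: exp_diff A_def B_def)
    have "exp l = exp (- l * t) * exp (l * (1 + t))"
      by (simp flip: exp_add add: algebra_simps)
    then have "two_point_mgf l t = exp (- l * t) * ((1 + t * exp (B - A)) / (1 + t))"
      unfolding two_point_mgf_def l_eq[symmetric] by (simp add: algebra_simps)
    also have "(1 + t * exp (B - A)) / (1 + t) = n / (n - x)"
    proof -
      have "t * exp (B - A) = (x + v\<^sup>2) / (n - x)"
        unfolding exp_AB using v2 n by (simp add: t_def)
      then have "1 + t * exp (B - A) = (n + v\<^sup>2) / (n - x)" using True by (simp add: field_simps)
      moreover have "1 + t = (n + v\<^sup>2) / n" using n by (simp add: t_def field_simps)
      ultimately show ?thesis using n nv True by simp
    qed
    also have "n / (n - x) = exp B" using True n by (simp add: B_def)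
    finally have "two_point_mgf l t = exp (- l * t + B)" by (simp only: exp_add)
    then have "two_point_mgf l t ^ n = exp (n * (- l * t + B))" by (simp only: exp_of_nat_mult)
    also have "n * (- l * t + B) = - l * v\<^sup>2 + n * B"
      using nt by (simp add: algebra_simps)
    finally have "exp (- l * x) * two_point_mgf l t ^ n = exp (- l * (x + v\<^sup>2) + n * B)"
      by (simp flip: exp_add add: algebra_simps)
    also have "- l * (x + v\<^sup>2) + n * B = n / (n + v\<^sup>2) * ((x + v\<^sup>2) * A + (n - x) * B)"
      using n nv unfolding l_def by (simp add: divide_simps) (simp add: algebra_simps)
    also have "exp \<dots> = H_fun n x v"
      using True x v2 n xv nv by (simp add: H_fun_def powr_def A_def B_def exp_add ln_mult)
    finally show ?thesis using Q[OF l] by (simp add: t_def)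
  next
    case False
    \<comment> \<open>Taking \<open>exp l\<close> out of each of the \<open>n\<close> factors leaves
      \<open>exp (- l * (x - n))\<close> times a quantity with a finite limit as \<open>l\<close>
      grows.\<close>
    have bound: "Q \<le> exp (- l * (x - n)) * ((exp (- l * (1 + t)) + t) / (1 + t)) ^ n" if "l > 0" for l
    proof -
      have "two_point_mgf l t = exp l * ((exp (- l * (1 + t)) + t) / (1 + t))"
        by (simp add: two_point_mgf_def distrib_left algebra_simps flip: exp_add)
      then have "two_point_mgf l t ^ n = exp (n * l) * ((exp (- l * (1 + t)) + t) / (1 + t)) ^ n"
        by (simp only: power_mult_distrib exp_of_nat_mult)
      moreover have "exp (- l * x) * exp (n * l) = exp (- l * (x - n))"
        by (simp flip: exp_add add: algebra_simps)
      ultimately show ?thesis using Q[OF that] by (simp add: t_def mult.assoc[symmetric])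
    qed
    have lim0: "((\<lambda>l. exp (- l * c)) \<longlongrightarrow> 0) at_top" if "c > 0" for c :: real
      using that by real_asymp
    have lim: "((\<lambda>l. ((exp (- l * (1 + t)) + t) / (1 + t)) ^ n) \<longlongrightarrow> ((0 + t) / (1 + t)) ^ n) at_top"
      using t by (intro tendsto_power tendsto_divide tendsto_add tendsto_const lim0) auto
    show ?thesis
    proof (cases "x = n")
      case True
      have "Q \<le> (t / (1 + t)) ^ n"
        using bound True by (intro tendsto_lowerbound[OF lim[simplified]]) (auto intro!: eventually_mono[OF eventually_gt_at_top[of 0]])
      also have "t / (1 + t) = v\<^sup>2 / (n + v\<^sup>2)"
        using n v by (simp add: t_def field_simps)
      \<comment> \<open>At \<open>x = n\<close> the outer exponent
        \<open>n / (n + v\<^sup>2)\<close> cancels the inner exponent \<open>x + v\<^sup>2\<close>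
        and leaves \<open>n\<close>.\<close>
      also have "(v\<^sup>2 / (n + v\<^sup>2)) ^ n = H_fun n x v"
        using n v True add_pos_pos[of "real n" "v\<^sup>2"] by (simp add: H_fun_def powr_powr powr_realpow)
      finally show ?thesis .
    next
      case neq: False
      then have "x - n > 0" using False by simp
      from tendsto_mult[OF lim0[OF this] lim]
      have "Q \<le> 0 * (t / (1 + t)) ^ n"
        using bound by (intro tendsto_lowerbound[of _ _ at_top]) (auto intro!: eventually_mono[OF eventually_gt_at_top[of 0]])
      then show ?thesis using False neq by (simp add: H_fun_def)
    qed
  qed
qed

subsection \<open>Conditional means\<close>

text \<open>As \<open>diag_coeff a 0 = 1\<close>, the separate summand \<open>a k\<close> becomes
  the term \<open>l = 0\<close>, and one formula also covers \<open>k = 0\<close>.\<close>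

lemma diag_coeff_eq: "diag_coeff a k = 1 + (\<Sum>l<k. diag_coeff a l * a (k - l))"
proof (cases "k = 0")
  case False
  then have "{..<k} = insert 0 {1..<k}" by auto
  with False show ?thesis by (subst diag_coeff.simps) (simp add: diag_coeff.simps[of a 0])
qed (simp add: diag_coeff.simps)

lemma diag_coeff_ge_1:
  assumes "\<And>i. i \<ge> 1 \<Longrightarrow> a i \<ge> 0"
  shows "diag_coeff a k \<ge> 1"
proof (induction k rule: less_induct)
  case (less k)
  have "diag_coeff a l * a (k - l) \<ge> 0" if "l < k" for l
    using less[OF that] assms[of "k - l"] that by (intro mult_nonneg_nonneg) auto
  then show ?case by (subst diag_coeff_eq) (auto intro!: sum_nonneg)
qed

text \<open>After reindexing, the weights \<open>a (Suc j)\<close> do not depend on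
  \<open>k\<close>, so the sums for \<open>k\<close> and \<open>Suc k\<close> compare term by term
  by the induction hypothesis; the one extra term is nonnegative.\<close>

lemma diag_coeff_le_Suc:
  assumes "\<And>i. i \<ge> 1 \<Longrightarrow> a i \<ge> 0"
  shows "diag_coeff a k \<le> diag_coeff a (Suc k)"
proof (induction k rule: less_induct)
  case (less k)
  have eq: "diag_coeff a m = 1 + (\<Sum>j<m. a (Suc j) * diag_coeff a (m - Suc j))" for m
    by (subst diag_coeff_eq, subst sum.nat_diff_reindex[symmetric])
      (auto intro!: sum.cong simp: mult.commute Suc_diff_Suc)
  have "(\<Sum>j<k. a (Suc j) * diag_coeff a (k - Suc j)) \<le> (\<Sum>j<k. a (Suc j) * diag_coeff a (Suc k - Suc j))"
  proof (intro sum_mono mult_left_mono)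
    fix j assume "j \<in> {..<k}"
    then show "diag_coeff a (k - Suc j) \<le> diag_coeff a (Suc k - Suc j)"
      using less[of "k - Suc j"] by (simp add: Suc_diff_Suc)
  qed (simp add: assms)
  moreover have "a (Suc k) * diag_coeff a 0 \<ge> 0"
    using assms[of "Suc k"] by (simp add: diag_coeff.simps)
  ultimately show ?case by (subst (1 2) eq) simp
qed

lemma diag_coeff_mono:
  assumes "\<And>i. i \<ge> 1 \<Longrightarrow> a i \<ge> 0" "j \<le> k"
  shows "diag_coeff a j \<le> diag_coeff a k"
  using lift_Suc_mono_le[of "diag_coeff a"] diag_coeff_le_Suc assms by blast

text \<open>The assumptions are restated through the laws \<open>P m\<close> alone, so that the
  analysis runs on the product space whose coordinates are the innovations. A probability measure is
  required at every index, including 0, as \<open>product_prob_space\<close> demands.\<close>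

locale contracting_recursion =
  fixes P :: "nat \<Rightarrow> 'y::polish_space measure"
    and F :: "nat \<Rightarrow> (nat \<Rightarrow> 'x::polish_space) \<Rightarrow> 'y \<Rightarrow> 'x"
    and X0 :: "int \<Rightarrow> 'x"
    and a V :: "nat \<Rightarrow> real"
    and f :: "(nat \<Rightarrow> 'x) \<Rightarrow> real"
    and n :: nat
  assumes prob_P: "\<And>m. prob_space (P m)"
    and sets_P [measurable_cong, simp]: "\<And>m. sets (P m) = sets borel"
    and F_meas: "\<And>m. m \<ge> 1 \<Longrightarrow>
      (\<lambda>(u, z). F m u z) \<in> borel_measurable ((\<Pi>\<^sub>M j\<in>UNIV. borel) \<Otimes>\<^sub>M borel)"
    and a_nonneg: "\<And>i. i \<ge> 1 \<Longrightarrow> a i \<ge> 0"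
    and contraction: "\<And>m u u'. m \<ge> 1 \<Longrightarrow>
      (\<integral>\<^sup>+ z. ennreal (dist (F m u z) (F m u' z)) \<partial>P m) \<le> (\<Sum>j. ennreal (a (Suc j) * dist (u j) (u' j)))"
    and f_lipschitz: "\<And>p p'. p \<in> {1..n} \<rightarrow>\<^sub>E UNIV \<Longrightarrow> p' \<in> {1..n} \<rightarrow>\<^sub>E UNIV \<Longrightarrow>
      \<bar>f p - f p'\<bar> \<le> (\<Sum>i=1..n. dist (p i) (p' i))"
    and F_lipschitz: "\<And>m u z z'. m \<ge> 1 \<Longrightarrow> dist (F m u z) (F m u z') \<le> dist z z'"
    and G_square: "\<And>k. k \<in> {1..n} \<Longrightarrow> (\<integral>\<^sup>+ z. (G_fun (P k) z)\<^sup>2 \<partial>P k) \<le> ennreal (V k)"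
    and V_pos: "\<And>k. k \<in> {1..n} \<Longrightarrow> V k > 0"
begin

section \<open>Innovation laws and integrability of Lipschitz functions\<close>

lemma space_P [simp]: "space (P m) = UNIV"
  using sets_eq_imp_space_eq[OF sets_P] by simp

lemma emeasure_P [simp]: "emeasure (P m) UNIV = 1"
  using prob_space.emeasure_space_1[OF prob_P] by simp

lemma measure_P [simp]: "measure (P m) UNIV = 1"
  by (simp add: measure_def)

sublocale P: product_prob_space P
  using prob_P by (simp add: product_prob_space_def product_prob_space_axioms_def product_sigma_finite_def prob_space_imp_sigma_finite)

lemma G_measurable [measurable]: "G_fun (P k) \<in> borel_measurable borel"
proof -
  interpret prob_space "P k" by (rule prob_P)
  show ?thesis unfolding G_fun_def by measurable
qed

text \<open>The second moment controls the first by \<open>x \<le> 1 + x\<^sup>2\<close>, which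
  holds in \<open>ennreal\<close> also at infinity.\<close>

lemma G_integral_finite:
  assumes "k \<in> {1..n}"
  shows "(\<integral>\<^sup>+ z. G_fun (P k) z \<partial>P k) < \<infinity>"
proof -
  have *: "x \<le> 1 + x\<^sup>2" for x :: ennreal
  proof (cases x)
    case (real r)
    have "r \<le> 1 + r\<^sup>2" using zero_le_power2[of "r - 1"] real by (simp add: power2_diff)
    with real show ?thesis by (simp add: ennreal_power flip: ennreal_1 ennreal_plus)
  qed (simp add: power2_eq_square ennreal_top_mult)
  have "(\<integral>\<^sup>+ z. G_fun (P k) z \<partial>P k) \<le> (\<integral>\<^sup>+ z. 1 + (G_fun (P k) z)\<^sup>2 \<partial>P k)"
    by (intro nn_integral_mono *)
  also have "\<dots> = 1 + (\<integral>\<^sup>+ z. (G_fun (P k) z)\<^sup>2 \<partial>P k)"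
    by (subst nn_integral_add) auto
  also have "\<dots> \<le> 1 + ennreal (V k)" by (intro add_left_mono G_square assms)
  also have "\<dots> < \<infinity>" by simp
  finally show ?thesis .
qed

text \<open>The growth of \<open>g\<close> is at most linear in the distance to a point
  \<open>z0\<close> of finite mean distance; such a point exists because \<open>G_fun (P k)\<close>
  has a finite integral.\<close>

lemma lipschitz_integrable:
  fixes g :: "'y \<Rightarrow> real"
  assumes k: "k \<in> {1..n}" and c: "c \<ge> 0" and g: "\<And>z z'. \<bar>g z - g z'\<bar> \<le> c * dist z z'"
  shows "integrable (P k) g"
proof -
  have "\<exists>z0. G_fun (P k) z0 < \<infinity>"
  proof (rule ccontr)
    assume "\<nexists>z0. G_fun (P k) z0 < \<infinity>"
    then have "(\<integral>\<^sup>+ z. G_fun (P k) z \<partial>P k) = (\<integral>\<^sup>+ z. \<top> \<partial>P k)" 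
      by (intro nn_integral_cong) (simp add: less_top[symmetric])
    then show False using G_integral_finite[OF k] by simp
  qed
  then obtain z0 where z0: "G_fun (P k) z0 < \<infinity>" by blast
  have "continuous_on UNIV g"
    using c g by (intro lipschitz_on_continuous_on[of c] lipschitz_onI) (auto simp: dist_real_def)
  then have [measurable]: "g \<in> borel_measurable borel" by (rule borel_measurable_continuous_onI)
  have int: "integrable (P k) (\<lambda>z. dist z0 z)"
    using z0 by (intro integrableI_bounded) (auto simp: G_fun_def)
  show ?thesis
  proof (rule Bochner_Integration.integrable_bound)
    show "integrable (P k) (\<lambda>z. \<bar>g z0\<bar> + c * dist z0 z)" using int by auto
    have "\<bar>g z\<bar> \<le> \<bar>g z0\<bar> + c * dist z0 z" for z using g[of z z0] by (simp add: dist_commute)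
    then show "AE z in P k. norm (g z) \<le> norm (\<bar>g z0\<bar> + c * dist z0 z)" using c by simp
  qed simp
qed

section \<open>Backward recursion for the conditional means\<close>

definition past :: "(int \<Rightarrow> 'x) \<Rightarrow> nat \<Rightarrow> nat \<Rightarrow> 'x" where
  "past h k = (\<lambda>j. h (int k - int (Suc j)))"

definition step :: "nat \<Rightarrow> (int \<Rightarrow> 'x) \<Rightarrow> 'y \<Rightarrow> int \<Rightarrow> 'x" where
  "step k h z = h(int k := F k (past h k) z)"

text \<open>The trajectory driven by \<open>e\<close> up to time \<open>k\<close>. Later times hold
  the values of \<open>X0\<close> as placeholders, which are overwritten before they are
  read.\<close>

primrec hist :: "(nat \<Rightarrow> 'y) \<Rightarrow> nat \<Rightarrow> int \<Rightarrow> 'x" where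
  "hist e 0 = X0"
| "hist e (Suc k) = step (Suc k) (hist e k) (e (Suc k))"

text \<open>\<open>cond_mean j h\<close> is the conditional expectation of \<open>f (X\<^sub>1, \<dots>, X\<^sub>n)\<close> given that the
  process agrees with \<open>h\<close> up to time \<open>n - j\<close>.\<close>
primrec cond_mean :: "nat \<Rightarrow> (int \<Rightarrow> 'x) \<Rightarrow> real" where
  "cond_mean 0 h = f (\<lambda>i\<in>{1..n}. h (int i))"
| "cond_mean (Suc j) h = (\<integral>z. cond_mean j (step (n - j) h z) \<partial>P (n - j))"

text \<open>The Lipschitz constant of \<open>cond_mean j\<close> in the coordinate at time
  \<open>i\<close>. Integrating out time \<open>n - l\<close> adds the constant of that coordinate,
  \<open>diag_coeff a l\<close>, times the weight \<open>a (n - l - i)\<close> of time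
  \<open>i\<close> in its recursion.\<close>

definition lip_coeff :: "nat \<Rightarrow> nat \<Rightarrow> real" where
  "lip_coeff j i = 1 + (\<Sum>l<j. diag_coeff a l * a (n - l - i))"

lemma diag_coeff_pos: "diag_coeff a k > 0"
  using diag_coeff_ge_1[of a k] a_nonneg by force

text \<open>At the latest time \<open>n - j\<close> the weights become \<open>a (j - l)\<close>,
  which is the recursion for \<open>diag_coeff\<close>.\<close>

lemma lip_coeff_diag: "j \<le> n \<Longrightarrow> lip_coeff j (n - j) = diag_coeff a j"
  by (subst diag_coeff_eq) (auto simp: lip_coeff_def intro!: sum.cong)

lemma F_measurable [measurable]: "m \<ge> 1 \<Longrightarrow> F m u \<in> borel_measurable borel"
  using F_lipschitz by (intro borel_measurable_continuous_onI lipschitz_on_continuous_on[of 1] lipschitz_onI) auto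

text \<open>Agreement at nonpositive times reduces the series in the contraction assumption to a
  finite sum, so the mean distance is finite and can be handled as a real integral.\<close>

lemma contraction_finite:
  assumes k: "k \<ge> 1" and h: "\<And>i. i \<le> 0 \<Longrightarrow> h i = h' i"
  defines "\<delta> \<equiv> \<lambda>z. dist (F k (past h k) z) (F k (past h' k) z)"
  shows "integrable (P k) \<delta>"
    and "integral\<^sup>L (P k) \<delta> \<le> (\<Sum>i=1..k-1. a (k - i) * dist (h (int i)) (h' (int i)))"
proof -
  have [measurable]: "F k u \<in> borel_measurable borel" for u using k by (rule F_measurable)
  have [measurable]: "\<delta> \<in> borel_measurable borel" unfolding \<delta>_def by measurable
  have "(\<integral>\<^sup>+ z. ennreal (\<delta> z) \<partial>P k) \<le> (\<Sum>j. ennreal (a (Suc j) * dist (past h k j) (past h' k j)))"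
    unfolding \<delta>_def by (rule contraction[OF k])
  also have "\<dots> = (\<Sum>j<k-1. ennreal (a (Suc j) * dist (past h k j) (past h' k j)))"
    using k h by (intro suminf_finite) (auto simp: past_def)
  also have "\<dots> = ennreal (\<Sum>j<k-1. a (Suc j) * dist (past h k j) (past h' k j))"
    using a_nonneg by (intro sum_ennreal) auto
  also have "(\<Sum>j<k-1. a (Suc j) * dist (past h k j) (past h' k j)) = (\<Sum>i=1..k-1. a (k - i) * dist (h (int i)) (h' (int i)))"
    by (rule sum.reindex_bij_witness[of _ "\<lambda>i. k - 1 - i" "\<lambda>j. k - 1 - j"])
      (auto simp: past_def Suc_diff_Suc of_nat_diff)
  finally have le: "(\<integral>\<^sup>+ z. ennreal (\<delta> z) \<partial>P k) \<le> ennreal (\<Sum>i=1..k-1. a (k - i) * dist (h (int i)) (h' (int i)))" .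
  then have "(\<integral>\<^sup>+ z. ennreal (\<delta> z) \<partial>P k) < \<infinity>" by (rule le_less_trans) simp
  then show int: "integrable (P k) \<delta>"
    by (intro integrableI_bounded) (auto simp: \<delta>_def)
  have "0 \<le> (\<Sum>i=1..k-1. a (k - i) * dist (h (int i)) (h' (int i)))"
    using a_nonneg by (intro sum_nonneg mult_nonneg_nonneg) auto
  moreover have "ennreal (integral\<^sup>L (P k) \<delta>) = (\<integral>\<^sup>+ z. ennreal (\<delta> z) \<partial>P k)"
    using int by (intro nn_integral_eq_integral[symmetric]) (auto simp: \<delta>_def)
  ultimately show "integral\<^sup>L (P k) \<delta> \<le> (\<Sum>i=1..k-1. a (k - i) * dist (h (int i)) (h' (int i)))"
    using le by (metis ennreal_le_iff)
qed

text \<open>Backward induction in time: the coordinate at \<open>k = n - j\<close> is replaced by a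
  value of \<open>F k\<close>, and the contraction assumption spreads its constant over the earlier
  coordinates.\<close>

lemma cond_mean_lipschitz:
  assumes "j \<le> n" "\<And>i. i \<le> 0 \<Longrightarrow> h i = h' i"
  shows "\<bar>cond_mean j h - cond_mean j h'\<bar> \<le> (\<Sum>i=1..n-j. lip_coeff j i * dist (h (int i)) (h' (int i)))"
  using assms
proof (induction j arbitrary: h h')
  case 0
  have "\<bar>cond_mean 0 h - cond_mean 0 h'\<bar>
      \<le> (\<Sum>i=1..n. dist ((\<lambda>i\<in>{1..n}. h (int i)) i) ((\<lambda>i\<in>{1..n}. h' (int i)) i))"
    unfolding cond_mean.simps by (rule f_lipschitz) auto
  also have "\<dots> = (\<Sum>i=1..n-0. lip_coeff 0 i * dist (h (int i)) (h' (int i)))"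
    by (auto simp: lip_coeff_def intro!: sum.cong)
  finally show ?case .
next
  case (Suc j)
  define k where "k = n - j"
  have k: "k \<in> {1..n}" and k1: "k \<ge> 1" using Suc.prems by (auto simp: k_def)
  have split: "{1..n-j} = insert k {1..n - Suc j}" "k \<notin> {1..n - Suc j}"
    using Suc.prems by (auto simp: k_def)
  \<comment> \<open>Both histories and innovations may differ, so one estimate serves for
    integrability (\<open>g = g'\<close>) and for the comparison of \<open>h\<close> with
    \<open>h'\<close> (\<open>z = z'\<close>).\<close>
  have lip: "\<bar>cond_mean j (step k g z) - cond_mean j (step k g' z')\<bar>
      \<le> diag_coeff a j * dist (F k (past g k) z) (F k (past g' k) z')
        + (\<Sum>i=1..n - Suc j. lip_coeff j i * dist (g (int i)) (g' (int i)))"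
    if "\<And>i. i \<le> 0 \<Longrightarrow> g i = g' i" for g g' z z'
  proof -
    have "\<bar>cond_mean j (step k g z) - cond_mean j (step k g' z')\<bar>
        \<le> (\<Sum>i=1..n-j. lip_coeff j i * dist (step k g z (int i)) (step k g' z' (int i)))"
      using Suc.prems that k1 by (intro Suc.IH) (auto simp: step_def)
    also have "\<dots> = lip_coeff j k * dist (F k (past g k) z) (F k (past g' k) z')
        + (\<Sum>i=1..n - Suc j. lip_coeff j i * dist (g (int i)) (g' (int i)))"
      unfolding split(1) using split(2) by (subst sum.insert) (auto simp: step_def intro!: sum.cong)
    finally show ?thesis using Suc.prems lip_coeff_diag[of j] by (simp add: k_def)
  qed
  have int: "integrable (P k) (\<lambda>z. cond_mean j (step k g z))" for g
  proof (rule lipschitz_integrable[OF k])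
    fix z z'
    have "\<bar>cond_mean j (step k g z) - cond_mean j (step k g z')\<bar>
        \<le> diag_coeff a j * dist (F k (past g k) z) (F k (past g k) z')"
      using lip[of g g z z'] by simp
    also have "\<dots> \<le> diag_coeff a j * dist z z'"
      using diag_coeff_pos[of j] k1 by (intro mult_left_mono F_lipschitz) auto
    finally show "\<bar>cond_mean j (step k g z) - cond_mean j (step k g z')\<bar> \<le> diag_coeff a j * dist z z'" .
  qed (use diag_coeff_pos[of j] in simp)
  let ?c = "\<Sum>i=1..n - Suc j. lip_coeff j i * dist (h (int i)) (h' (int i))"
  let ?\<delta> = "\<lambda>z. dist (F k (past h k) z) (F k (past h' k) z)"
  note fin = contraction_finite[OF k1 Suc.prems(2)]
  have "\<bar>cond_mean (Suc j) h - cond_mean (Suc j) h'\<bar>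
      = \<bar>\<integral>z. cond_mean j (step k h z) - cond_mean j (step k h' z) \<partial>P k\<bar>"
    using int by (simp add: k_def)
  also have "\<dots> \<le> (\<integral>z. \<bar>cond_mean j (step k h z) - cond_mean j (step k h' z)\<bar> \<partial>P k)"
    by (rule integral_abs_bound)
  also have "\<dots> \<le> (\<integral>z. diag_coeff a j * ?\<delta> z + ?c \<partial>P k)"
    using int fin Suc.prems(2) by (intro integral_mono lip) auto
  also have "\<dots> = diag_coeff a j * (\<integral>z. ?\<delta> z \<partial>P k) + ?c"
    using fin(1) by simp
  also have "\<dots> \<le> diag_coeff a j * (\<Sum>i=1..k-1. a (k - i) * dist (h (int i)) (h' (int i))) + ?c"
    using fin(2) diag_coeff_pos[of j] by (intro add_right_mono mult_left_mono) auto
  \<comment> \<open>The coefficient at \<open>i\<close> is now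
    \<open>lip_coeff j i + diag_coeff a j * a (n - j - i)\<close>.\<close>
  also have "\<dots> = (\<Sum>i=1..n - Suc j. lip_coeff (Suc j) i * dist (h (int i)) (h' (int i)))"
    using Suc.prems by (auto simp: k_def lip_coeff_def sum_distrib_left algebra_simps simp flip: sum.distrib intro!: sum.cong)
  finally show ?case .
qed

lemma cond_mean_step_lipschitz:
  assumes k: "k \<in> {1..n}"
  shows "\<bar>cond_mean (n - k) (step k h z) - cond_mean (n - k) (step k h z')\<bar> \<le> diag_coeff a (n - k) * dist z z'"
proof -
  have nk: "n - (n - k) = k" using k by auto
  have "\<bar>cond_mean (n - k) (step k h z) - cond_mean (n - k) (step k h z')\<bar>
      \<le> (\<Sum>i=1..k. lip_coeff (n - k) i * dist (step k h z (int i)) (step k h z' (int i)))"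
    using cond_mean_lipschitz[of "n - k" "step k h z" "step k h z'"] k nk by (auto simp: step_def)
  also have "\<dots> = (\<Sum>i=1..k. if i = k then lip_coeff (n - k) k * dist (F k (past h k) z) (F k (past h k) z') else 0)"
    by (intro sum.cong) (auto simp: step_def)
  also have "\<dots> = diag_coeff a (n - k) * dist (F k (past h k) z) (F k (past h k) z')"
    using k lip_coeff_diag[of "n - k"] nk by simp
  also have "\<dots> \<le> diag_coeff a (n - k) * dist z z'"
    using k diag_coeff_pos[of "n - k"] by (intro mult_left_mono F_lipschitz) auto
  finally show ?thesis .
qed

section \<open>Martingale increments and their domination by \<open>G_fun\<close>\<close>

definition mart_diff :: "nat \<Rightarrow> (int \<Rightarrow> 'x) \<Rightarrow> 'y \<Rightarrow> real" where
  "mart_diff k h z = cond_mean (n - k) (step k h z) - (\<integral>z'. cond_mean (n - k) (step k h z') \<partial>P k)"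

lemma integrable_cond_mean_step:
  assumes "k \<in> {1..n}"
  shows "integrable (P k) (\<lambda>z. cond_mean (n - k) (step k h z))"
  using diag_coeff_pos[of "n - k"]
  by (intro lipschitz_integrable[OF assms _ cond_mean_step_lipschitz[OF assms]]) auto

lemma integrable_mart_diff:
  assumes "k \<in> {1..n}"
  shows "integrable (P k) (mart_diff k h)" "integral\<^sup>L (P k) (mart_diff k h) = 0"
  using integrable_cond_mean_step[OF assms, of h] by (simp_all add: mart_diff_def[abs_def])

text \<open>The increment averages, over an independent copy \<open>z'\<close>, the difference of
  the values at \<open>z\<close> and \<open>z'\<close>; the Lipschitz bound then integrates to
  \<open>G_fun\<close>.\<close>

lemma mart_diff_le_G:
  assumes k: "k \<in> {1..n}"
  shows "ennreal \<bar>mart_diff k h z\<bar> \<le> ennreal (diag_coeff a (n - k)) * G_fun (P k) z"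
proof -
  let ?g = "\<lambda>z. cond_mean (n - k) (step k h z)"
  have int: "integrable (P k) ?g" by (rule integrable_cond_mean_step[OF k])
  then have [measurable]: "?g \<in> borel_measurable borel" by (simp add: borel_measurable_integrable cong: measurable_cong_sets)
  have "mart_diff k h z = (\<integral>z'. ?g z - ?g z' \<partial>P k)"
    using int by (simp add: mart_diff_def)
  then have "ennreal \<bar>mart_diff k h z\<bar> \<le> (\<integral>\<^sup>+ z'. ennreal \<bar>?g z - ?g z'\<bar> \<partial>P k)"
    using integral_norm_bound_ennreal[of "P k" "\<lambda>z'. ?g z - ?g z'"] int by simp
  also have "\<dots> \<le> (\<integral>\<^sup>+ z'. ennreal (diag_coeff a (n - k)) * ennreal (dist z z') \<partial>P k)"
    using diag_coeff_pos[of "n - k"] cond_mean_step_lipschitz[OF k, of h z]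
    by (intro nn_integral_mono) (auto simp flip: ennreal_mult intro!: ennreal_leI)
  also have "\<dots> = ennreal (diag_coeff a (n - k)) * G_fun (P k) z"
    unfolding G_fun_def by (rule nn_integral_cmult) simp
  finally show ?thesis .
qed

subsection \<open>Product space of the innovations\<close>

lemma hist_nonpos: "i \<le> 0 \<Longrightarrow> hist e k i = X0 i"
  by (induction k) (auto simp: step_def)

lemma hist_cong: "(\<And>i. i \<in> {1..k} \<Longrightarrow> e i = e' i) \<Longrightarrow> hist e k = hist e' k"
  by (induction k) auto

lemma hist_upd: "k < m \<Longrightarrow> hist (e(m := z)) k = hist e k"
  by (rule hist_cong) auto

text \<open>Once nonpositive times are frozen at \<open>X0\<close>, as the Lipschitz estimate
  requires, \<open>cond_mean j\<close> is continuous in the product topology, because only finitely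
  many coordinates enter the estimate.\<close>

lemma cond_mean_measurable:
  assumes g: "\<And>i. (\<lambda>e. g e i) \<in> borel_measurable N"
    and g0: "\<And>e i. e \<in> space N \<Longrightarrow> i \<le> 0 \<Longrightarrow> g e i = X0 i" and j: "j \<le> n"
  shows "(\<lambda>e. cond_mean j (g e)) \<in> borel_measurable N"
proof -
  define \<phi> where "\<phi> p = cond_mean j (\<lambda>i. if i \<le> 0 then X0 i else p i)" for p :: "int \<Rightarrow> 'x"
  have "isCont \<phi> p" for p
  proof -
    have coord: "((\<lambda>q. q i) \<longlongrightarrow> p i) (at p)" for i
      using continuous_on_product_coordinates[of i] by (auto simp: continuous_on_def)
    have "((\<lambda>q. \<Sum>i=1..n-j. lip_coeff j i * dist (q (int i)) (p (int i))) \<longlongrightarrow>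
        (\<Sum>i=1..n-j. lip_coeff j i * dist (p (int i)) (p (int i)))) (at p)"
      by (intro tendsto_intros coord)
    then have lim: "((\<lambda>q. \<Sum>i=1..n-j. lip_coeff j i * dist (q (int i)) (p (int i))) \<longlongrightarrow> 0) (at p)" by simp
    have bound: "dist (\<phi> q) (\<phi> p) \<le> (\<Sum>i=1..n-j. lip_coeff j i * dist (q (int i)) (p (int i)))" for q
      unfolding \<phi>_def dist_real_def by (rule order_trans[OF cond_mean_lipschitz[OF j]]) auto
    have "((\<lambda>q. dist (\<phi> q) (\<phi> p)) \<longlongrightarrow> 0) (at p)"
      by (rule tendsto_sandwich[OF _ _ tendsto_const lim]) (simp_all only: bound zero_le_dist always_eventually simp_thms)
    then show "isCont \<phi> p" unfolding isCont_def by (subst tendsto_dist_iff)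
  qed
  then have "\<phi> \<in> borel_measurable borel"
    by (intro borel_measurable_continuous_onI continuous_at_imp_continuous_on) auto
  moreover have "g \<in> borel_measurable N" by (rule measurable_coordinatewise_then_product[OF g])
  ultimately have "(\<lambda>e. \<phi> (g e)) \<in> borel_measurable N" by (rule measurable_compose_rev)
  moreover have "\<phi> (g e) = cond_mean j (g e)" if "e \<in> space N" for e
    unfolding \<phi>_def using g0[OF that] by (intro arg_cong[of _ _ "cond_mean j"]) auto
  ultimately show ?thesis by (simp cong: measurable_cong)
qed

lemma hist_measurable: "{1..k} \<subseteq> I \<Longrightarrow> (\<lambda>e. hist e k i) \<in> borel_measurable (Pi\<^sub>M I P)"
proof (induction k arbitrary: i)
  case (Suc k)
  have I: "{1..k} \<subseteq> I" "Suc k \<in> I" using Suc.prems by auto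
  have "(\<lambda>e. (past (hist e k) (Suc k), e (Suc k))) \<in> Pi\<^sub>M I P \<rightarrow>\<^sub>M (\<Pi>\<^sub>M j\<in>UNIV. borel) \<Otimes>\<^sub>M borel"
  proof (rule measurable_Pair)
    show "(\<lambda>e. past (hist e k) (Suc k)) \<in> Pi\<^sub>M I P \<rightarrow>\<^sub>M (\<Pi>\<^sub>M j\<in>UNIV. borel)"
      unfolding past_def by (rule measurable_PiM_single') (auto intro: Suc.IH[OF I(1)])
    show "(\<lambda>e. e (Suc k)) \<in> Pi\<^sub>M I P \<rightarrow>\<^sub>M borel"
      using measurable_component_singleton[OF I(2), of P] by (simp cong: measurable_cong_sets)
  qed
  from measurable_compose[OF this F_meas[of "Suc k"]]
  have "(\<lambda>e. F (Suc k) (past (hist e k) (Suc k)) (e (Suc k))) \<in> borel_measurable (Pi\<^sub>M I P)" by simp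
  then show ?case using Suc.IH[OF I(1), of i] by (cases "i = int (Suc k)") (simp_all add: step_def)
qed simp

lemma cond_mean_hist_measurable:
  assumes "{1..k} \<subseteq> I" "j \<le> n"
  shows "(\<lambda>e. cond_mean j (hist e k)) \<in> borel_measurable (Pi\<^sub>M I P)"
  by (rule cond_mean_measurable[OF hist_measurable[OF assms(1)] hist_nonpos assms(2)])

text \<open>The integral in \<open>mart_diff\<close> is one unfolding of \<open>cond_mean\<close>,
  since \<open>n - (k - 1) = Suc (n - k)\<close>.\<close>

lemma mart_diff_hist:
  assumes "k \<in> {1..n}"
  shows "mart_diff k (hist e (k - 1)) (e k) = cond_mean (n - k) (hist e k) - cond_mean (n - (k - 1)) (hist e (k - 1))"
proof -
  obtain m where m: "k = Suc m" using assms by (cases k) auto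
  have "n - m = Suc (n - k)" "n - (n - k) = k" using assms m by auto
  then show ?thesis by (simp add: mart_diff_def m)
qed

text \<open>Joint measurability in all innovations comes from writing the increment as a difference
  of two conditional means.\<close>

lemma mart_diff_measurable:
  assumes "k \<in> {1..n}" "{1..k} \<subseteq> I"
  shows "(\<lambda>e. mart_diff k (hist e (k - 1)) (e k)) \<in> borel_measurable (Pi\<^sub>M I P)"
proof -
  have "{1..k-1} \<subseteq> I" using assms(2) by (rule subset_trans[rotated]) auto
  then show ?thesis
    unfolding mart_diff_hist[OF assms(1)]
    using assms by (intro borel_measurable_diff cond_mean_hist_measurable) auto
qed

lemma cond_mean_telescope:
  "k \<le> n \<Longrightarrow> cond_mean (n - k) (hist e k) = cond_mean n X0 + (\<Sum>i=1..k. mart_diff i (hist e (i - 1)) (e i))"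
proof (induction k)
  case (Suc k)
  have "mart_diff (Suc k) (hist e k) (e (Suc k)) = cond_mean (n - Suc k) (hist e (Suc k)) - cond_mean (n - k) (hist e k)"
    using mart_diff_hist[of "Suc k" e] Suc.prems by simp
  with Suc show ?case by simp
qed simp

text \<open>Fubini integrates out the newest innovation, whose increment has mean zero for each
  fixed history. At \<open>k = n\<close> this identifies the mean of \<open>f\<close> along the
  trajectory.\<close>

lemma cond_mean_hist_integral:
  assumes "k \<le> n"
  shows "integrable (Pi\<^sub>M {1..k} P) (\<lambda>e. cond_mean (n - k) (hist e k))
    \<and> (\<integral>e. cond_mean (n - k) (hist e k) \<partial>Pi\<^sub>M {1..k} P) = cond_mean n X0"
  using assms
proof (induction k)
  case 0
  interpret prob_space "Pi\<^sub>M {} P" by (intro prob_space_PiM prob_P)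
  show ?case using prob_space by simp
next
  case (Suc k)
  define m where "m = Suc k"
  have m: "m \<in> {1..n}" and mk: "m \<notin> {1..k}" and ins: "{1..m} = insert m {1..k}"
    using Suc.prems by (auto simp: m_def)
  interpret prob_space "Pi\<^sub>M {1..k} P" by (intro prob_space_PiM prob_P)
  let ?T = "\<lambda>k e. cond_mean (n - k) (hist e k)"
  have IH: "integrable (Pi\<^sub>M {1..k} P) (?T k)" "(\<integral>e. ?T k e \<partial>Pi\<^sub>M {1..k} P) = cond_mean n X0"
    using Suc by auto
  have T_upd: "?T m (e(m := z)) = ?T k e + mart_diff m (hist e k) z" for e z
    using mart_diff_hist[OF m, of "e(m := z)"] by (simp add: m_def hist_upd)
  have meas: "?T m \<in> borel_measurable (Pi\<^sub>M (insert m {1..k}) P)"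
    using ins by (intro cond_mean_hist_measurable) auto
  have meas_D: "mart_diff m h \<in> borel_measurable (P m)" for h
    using integrable_mart_diff(1)[OF m] by (rule borel_measurable_integrable)
  \<comment> \<open>A bound on the mean absolute increment uniform in the history; it carries
    integrability from \<open>k\<close> to \<open>m\<close>.\<close>
  define K where "K = ennreal (diag_coeff a (n - m)) * (\<integral>\<^sup>+ z. G_fun (P m) z \<partial>P m)"
  have K: "K < \<infinity>" using G_integral_finite[OF m] by (simp add: K_def ennreal_mult_less_top)
  have D_le: "(\<integral>\<^sup>+ z. ennreal \<bar>mart_diff m h z\<bar> \<partial>P m) \<le> K" for h
  proof -
    have "(\<integral>\<^sup>+ z. ennreal \<bar>mart_diff m h z\<bar> \<partial>P m) \<le> (\<integral>\<^sup>+ z. ennreal (diag_coeff a (n - m)) * G_fun (P m) z \<partial>P m)"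
      by (intro nn_integral_mono mart_diff_le_G m)
    then show ?thesis by (simp add: K_def nn_integral_cmult)
  qed
  have "(\<integral>\<^sup>+ e. ennreal (norm (?T m e)) \<partial>Pi\<^sub>M (insert m {1..k}) P)
      = (\<integral>\<^sup>+ e. (\<integral>\<^sup>+ z. ennreal \<bar>?T k e + mart_diff m (hist e k) z\<bar> \<partial>P m) \<partial>Pi\<^sub>M {1..k} P)"
    using meas mk by (subst P.product_nn_integral_insert) (auto simp: T_upd)
  also have "\<dots> \<le> (\<integral>\<^sup>+ e. ennreal \<bar>?T k e\<bar> + K \<partial>Pi\<^sub>M {1..k} P)"
  proof (rule nn_integral_mono)
    fix e
    have "(\<integral>\<^sup>+ z. ennreal \<bar>?T k e + mart_diff m (hist e k) z\<bar> \<partial>P m)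
        \<le> (\<integral>\<^sup>+ z. ennreal \<bar>?T k e\<bar> + ennreal \<bar>mart_diff m (hist e k) z\<bar> \<partial>P m)"
      by (intro nn_integral_mono) (auto simp flip: ennreal_plus intro!: ennreal_leI)
    also have "\<dots> = ennreal \<bar>?T k e\<bar> + (\<integral>\<^sup>+ z. ennreal \<bar>mart_diff m (hist e k) z\<bar> \<partial>P m)"
      using meas_D by (subst nn_integral_add) auto
    also have "\<dots> \<le> ennreal \<bar>?T k e\<bar> + K" by (intro add_left_mono D_le)
    finally show "(\<integral>\<^sup>+ z. ennreal \<bar>?T k e + mart_diff m (hist e k) z\<bar> \<partial>P m) \<le> ennreal \<bar>?T k e\<bar> + K" .
  qed
  also have "\<dots> = (\<integral>\<^sup>+ e. ennreal (norm (?T k e)) \<partial>Pi\<^sub>M {1..k} P) + K"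
    using IH(1) emeasure_space_1 by (subst nn_integral_add) auto
  also have "\<dots> < \<infinity>"
    using IH(1) K by (simp add: integrable_iff_bounded)
  finally have int: "integrable (Pi\<^sub>M (insert m {1..k}) P) (?T m)"
    using meas by (intro integrableI_bounded)
  have "(\<integral>e. ?T m e \<partial>Pi\<^sub>M (insert m {1..k}) P) = (\<integral>e. (\<integral>z. ?T k e + mart_diff m (hist e k) z \<partial>P m) \<partial>Pi\<^sub>M {1..k} P)"
    using int mk by (subst P.product_integral_insert) (auto simp: T_upd)
  also have "\<dots> = cond_mean n X0"
    using IH(2) integrable_mart_diff[OF m] by simp
  finally show ?case using int unfolding m_def[symmetric] ins by simp
qed

text \<open>Truncation at \<open>G \<le> y\<close> makes the increment at most \<open>diag_coeff a (n - 1) * y\<close>, uniformly in \<open>k\<close>,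
  since \<open>diag_coeff\<close> is increasing.\<close>
lemma truncated_increment_mgf_le:
  assumes k: "k \<in> {1..n}" and s: "s \<in> {1, -1}" and y: "y > 0" and l: "l > 0"
  defines "c \<equiv> y * diag_coeff a (n - 1)"
  shows "(\<integral>\<^sup>+ z. ennreal (exp (l * (s * mart_diff k h z / c))) * indicator {z. G_fun (P k) z \<le> ennreal y} z \<partial>P k)
    \<le> ennreal (two_point_mgf l ((diag_coeff a (n - k))\<^sup>2 * V k / c\<^sup>2))"
proof -
  define b where "b = diag_coeff a (n - k)"
  have b: "b > 0" and c: "c > 0" using diag_coeff_pos y by (auto simp: b_def c_def)
  have bc: "b * y \<le> c"
    using diag_coeff_mono[of a "n - k" "n - 1"] a_nonneg k y by (auto simp: b_def c_def mult.commute)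
  have s_sq: "s\<^sup>2 = 1" and s_abs: "\<bar>s\<bar> = 1" using s by auto
  note D = integrable_mart_diff[OF k, of h]
  have [measurable]: "mart_diff k h \<in> borel_measurable borel"
    using borel_measurable_integrable[OF D(1)] by (simp cong: measurable_cong_sets)
  \<comment> \<open>The variance is that of the whole increment, which keeps its mean zero: only the
    exponential is truncated.\<close>
  have "(\<integral>\<^sup>+ z. ennreal ((mart_diff k h z)\<^sup>2) \<partial>P k) \<le> (\<integral>\<^sup>+ z. ennreal (b\<^sup>2) * (G_fun (P k) z)\<^sup>2 \<partial>P k)"
  proof (rule nn_integral_mono)
    fix z
    have "ennreal ((mart_diff k h z)\<^sup>2) = (ennreal \<bar>mart_diff k h z\<bar>)\<^sup>2" by (simp add: ennreal_power)
    also have "\<dots> \<le> (ennreal b * G_fun (P k) z)\<^sup>2"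
      unfolding b_def by (intro power_mono mart_diff_le_G k) simp
    also have "\<dots> = ennreal (b\<^sup>2) * (G_fun (P k) z)\<^sup>2"
      using b by (simp add: power_mult_distrib ennreal_power)
    finally show "ennreal ((mart_diff k h z)\<^sup>2) \<le> ennreal (b\<^sup>2) * (G_fun (P k) z)\<^sup>2" .
  qed
  also have "\<dots> = ennreal (b\<^sup>2) * (\<integral>\<^sup>+ z. (G_fun (P k) z)\<^sup>2 \<partial>P k)"
    by (rule nn_integral_cmult) simp
  also have "\<dots> \<le> ennreal (b\<^sup>2) * ennreal (V k)"
    by (intro mult_left_mono G_square k) simp
  also have "\<dots> = ennreal (b\<^sup>2 * V k)"
    using V_pos[OF k] by (simp add: ennreal_mult)
  finally have sq_le: "(\<integral>\<^sup>+ z. ennreal ((mart_diff k h z)\<^sup>2) \<partial>P k) \<le> ennreal (b\<^sup>2 * V k)" .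
  then have "(\<integral>\<^sup>+ z. ennreal ((mart_diff k h z)\<^sup>2) \<partial>P k) < \<infinity>" by (rule le_less_trans) simp
  then have sq_int: "integrable (P k) (\<lambda>z. (mart_diff k h z)\<^sup>2)" by (intro integrableI_bounded) auto
  have "ennreal (\<integral>z. (mart_diff k h z)\<^sup>2 \<partial>P k) \<le> ennreal (b\<^sup>2 * V k)"
    using sq_le sq_int by (subst nn_integral_eq_integral[symmetric]) auto
  then have var: "(\<integral>z. (mart_diff k h z)\<^sup>2 \<partial>P k) \<le> b\<^sup>2 * V k"
    using V_pos[OF k] by (subst (asm) ennreal_le_iff) auto
  have xi_sq: "(s * mart_diff k h z / c)\<^sup>2 = (mart_diff k h z)\<^sup>2 / c\<^sup>2" for z
    using s_sq by (simp add: power_divide power_mult_distrib)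
  show ?thesis
  proof (rule prob_space.truncated_mgf_le[OF prob_P])
    show "s * mart_diff k h z / c \<le> 1" if "z \<in> {z. G_fun (P k) z \<le> ennreal y}" for z
    proof -
      have "ennreal \<bar>mart_diff k h z\<bar> \<le> ennreal b * G_fun (P k) z"
        unfolding b_def by (rule mart_diff_le_G[OF k])
      also have "\<dots> \<le> ennreal b * ennreal y" using that by (intro mult_left_mono) auto
      also have "\<dots> = ennreal (b * y)" using b y by (simp add: ennreal_mult)
      finally have "\<bar>mart_diff k h z\<bar> \<le> b * y" using b y by (subst (asm) ennreal_le_iff) auto
      then have "\<bar>s * mart_diff k h z\<bar> \<le> c" using bc s_abs by (simp add: abs_mult)
      then show ?thesis using c by (simp add: divide_le_eq)
    qed
    show "(\<integral>z. (s * mart_diff k h z / c)\<^sup>2 \<partial>P k) \<le> (diag_coeff a (n - k))\<^sup>2 * V k / c\<^sup>2"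
      using var c by (simp add: xi_sq b_def divide_right_mono)
    show "integrable (P k) (\<lambda>z. (s * mart_diff k h z / c)\<^sup>2)" using sq_int by (simp add: xi_sq)
  qed (use D c b l V_pos[OF k] in \<open>auto simp: b_def\<close>)
qed

text \<open>With the earlier innovations fixed, the last factor integrates to at most a constant
  free of the history, so the factors can be removed one by one from the end.\<close>

lemma truncated_product_mgf_le:
  fixes s y l :: real
  assumes s: "s \<in> {1, -1}" and y: "y > 0" and l: "l > 0" and k: "k \<le> n"
  defines "c \<equiv> y * diag_coeff a (n - 1)"
  defines "R \<equiv> \<lambda>i h z. ennreal (exp (l * (s * mart_diff i h z / c))) * indicator {z. G_fun (P i) z \<le> ennreal y} z"
  shows "(\<integral>\<^sup>+ e. (\<Prod>i=1..k. R i (hist e (i - 1)) (e i)) \<partial>Pi\<^sub>M {1..k} P)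
    \<le> (\<Prod>i=1..k. ennreal (two_point_mgf l ((diag_coeff a (n - i))\<^sup>2 * V i / c\<^sup>2)))"
  using k
proof (induction k)
  case 0
  interpret prob_space "Pi\<^sub>M {} P" by (intro prob_space_PiM prob_P)
  show ?case using emeasure_space_1 by simp
next
  case (Suc k)
  define m where "m = Suc k"
  have m: "m \<in> {1..n}" and mk: "m \<notin> {1..k}" and ins: "{1..m} = insert m {1..k}"
    using Suc.prems by (auto simp: m_def)
  have R_meas: "(\<lambda>e. R i (hist e (i - 1)) (e i)) \<in> borel_measurable (Pi\<^sub>M I P)" if "i \<in> {1..n}" "{1..i} \<subseteq> I" for i I
  proof -
    have [measurable]: "(\<lambda>e. mart_diff i (hist e (i - 1)) (e i)) \<in> borel_measurable (Pi\<^sub>M I P)"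
      using that by (rule mart_diff_measurable)
    have [measurable]: "(\<lambda>e. e i) \<in> borel_measurable (Pi\<^sub>M I P)"
      using measurable_component_singleton[of i I P] that by (auto cong: measurable_cong_sets)
    show ?thesis unfolding R_def by measurable
  qed
  have prod_meas: "(\<lambda>e. \<Prod>i=1..j. R i (hist e (i - 1)) (e i)) \<in> borel_measurable (Pi\<^sub>M I P)" if "j \<le> n" "{1..j} \<subseteq> I" for j I
    using that by (intro borel_measurable_prod_ennreal R_meas) auto
  let ?B = "\<lambda>i. ennreal (two_point_mgf l ((diag_coeff a (n - i))\<^sup>2 * V i / c\<^sup>2))"
  \<comment> \<open>Changing the innovation at \<open>m\<close> affects the last factor
    only.\<close>
  have upd: "(\<Prod>i=1..m. R i (hist (e(m := z)) (i - 1)) ((e(m := z)) i))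
      = (\<Prod>i=1..k. R i (hist e (i - 1)) (e i)) * R m (hist e k) z" for e z
  proof -
    have "(\<Prod>i=1..k. R i (hist (e(m := z)) (i - 1)) ((e(m := z)) i)) = (\<Prod>i=1..k. R i (hist e (i - 1)) (e i))"
      using mk by (intro prod.cong refl) (auto simp: hist_upd m_def)
    moreover have "hist (e(m := z)) (m - 1) = hist e k" by (simp add: m_def hist_upd)
    ultimately show ?thesis unfolding ins using mk by (subst prod.insert) (auto simp: mult.commute)
  qed
  have "(\<integral>\<^sup>+ e. (\<Prod>i=1..m. R i (hist e (i - 1)) (e i)) \<partial>Pi\<^sub>M (insert m {1..k}) P)
      = (\<integral>\<^sup>+ e. (\<integral>\<^sup>+ z. (\<Prod>i=1..k. R i (hist e (i - 1)) (e i)) * R m (hist e k) z \<partial>P m) \<partial>Pi\<^sub>M {1..k} P)"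
    unfolding upd[symmetric] using mk m
    by (intro P.product_nn_integral_insert prod_meas) (auto simp: m_def)
  also have "\<dots> \<le> (\<integral>\<^sup>+ e. (\<Prod>i=1..k. R i (hist e (i - 1)) (e i)) * ?B m \<partial>Pi\<^sub>M {1..k} P)"
  proof (rule nn_integral_mono)
    fix e
    have "mart_diff m (hist e k) \<in> borel_measurable (P m)"
      using integrable_mart_diff(1)[OF m] by (rule borel_measurable_integrable)
    then have [measurable]: "mart_diff m (hist e k) \<in> borel_measurable borel" by (simp cong: measurable_cong_sets)
    have "(\<integral>\<^sup>+ z. (\<Prod>i=1..k. R i (hist e (i - 1)) (e i)) * R m (hist e k) z \<partial>P m)
        = (\<Prod>i=1..k. R i (hist e (i - 1)) (e i)) * (\<integral>\<^sup>+ z. R m (hist e k) z \<partial>P m)"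
      by (rule nn_integral_cmult) (simp add: R_def)
    also have "\<dots> \<le> (\<Prod>i=1..k. R i (hist e (i - 1)) (e i)) * ?B m"
      unfolding R_def c_def by (intro mult_left_mono truncated_increment_mgf_le m s y l) simp
    finally show "(\<integral>\<^sup>+ z. (\<Prod>i=1..k. R i (hist e (i - 1)) (e i)) * R m (hist e k) z \<partial>P m)
        \<le> (\<Prod>i=1..k. R i (hist e (i - 1)) (e i)) * ?B m" .
  qed
  also have "\<dots> = (\<integral>\<^sup>+ e. (\<Prod>i=1..k. R i (hist e (i - 1)) (e i)) \<partial>Pi\<^sub>M {1..k} P) * ?B m"
    using Suc.prems by (intro nn_integral_multc prod_meas) auto
  also have "\<dots> \<le> (\<Prod>i=1..k. ?B i) * ?B m"
    using Suc by (intro mult_right_mono) auto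
  also have "\<dots> = (\<Prod>i=1..m. ?B i)" unfolding ins using mk by (simp add: mult.commute)
  finally show ?case unfolding m_def[symmetric] ins .
qed

text \<open>The subtracted constant is the mean, by \<open>cond_mean_hist_integral\<close>.\<close>

definition centred :: "(nat \<Rightarrow> 'y) \<Rightarrow> real" where
  "centred e = f (\<lambda>i\<in>{1..n}. hist e n (int i)) - cond_mean n X0"

lemma centred_measurable [measurable]: "centred \<in> borel_measurable (Pi\<^sub>M {1..n} P)"
  using cond_mean_hist_measurable[of n "{1..n}" 0] by (simp add: centred_def[abs_def])

text \<open>Exponential Markov inequality on the truncated event: the product bound is largest for
  equal variances, and \<open>le_H_funI\<close> optimises over \<open>l\<close>.\<close>

lemma truncated_tail_le:
  assumes n: "n \<ge> 1" and s: "s \<in> {1, -1}" and y: "y > 0" and x: "x > 0"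
  defines "c \<equiv> y * diag_coeff a (n - 1)"
  shows "measure (Pi\<^sub>M {1..n} P) {e \<in> space (Pi\<^sub>M {1..n} P). s * centred e \<ge> x \<and> (\<forall>k\<in>{1..n}. G_fun (P k) (e k) \<le> ennreal y)}
    \<le> H_fun n (x / c) (sqrt (\<Sum>k=1..n. (diag_coeff a (n - k))\<^sup>2 * V k) / c)"
proof (rule le_H_funI)
  let ?Q = "Pi\<^sub>M {1..n} P"
  let ?v = "\<Sum>k=1..n. (diag_coeff a (n - k))\<^sup>2 * V k"
  let ?t = "\<lambda>i. (diag_coeff a (n - i))\<^sup>2 * V i / c\<^sup>2"
  interpret prob_space ?Q by (intro prob_space_PiM prob_P)
  have c: "c > 0" using diag_coeff_pos y by (simp add: c_def)
  have v: "?v > 0"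
    using n V_pos diag_coeff_pos by (intro sum_pos mult_pos_pos zero_less_power) auto
  show "n \<ge> 1" "x / c > 0" "sqrt ?v / c > 0" using n x c v by auto
  fix l :: real assume l: "l > 0"
  let ?R = "\<lambda>i h z. ennreal (exp (l * (s * mart_diff i h z / c))) * indicator {z. G_fun (P i) z \<le> ennreal y} z"
  have t0: "two_point_mgf l (?t i) \<ge> 0" if "i \<in> {1..n}" for i
    using V_pos[OF that] by (intro two_point_mgf_nonneg) (auto intro!: mult_nonneg_nonneg divide_nonneg_nonneg)
  define E where "E = {e \<in> space ?Q. s * centred e \<ge> x \<and> (\<forall>k\<in>{1..n}. G_fun (P k) (e k) \<le> ennreal y)}"
  have [measurable]: "(\<lambda>e. e i) \<in> borel_measurable ?Q" if "i \<in> {1..n}" for i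
    using measurable_component_singleton[OF that, of P] by (simp cong: measurable_cong_sets)
  have E: "E \<in> sets ?Q" unfolding E_def by measurable
  \<comment> \<open>On \<open>E\<close> all indicators are 1 and the product telescopes to
    \<open>exp (l * (s * centred e / c))\<close>, which is at least
    \<open>exp (l * (x / c))\<close>; off \<open>E\<close> the left side is 0.\<close>
  have "indicator E e \<le> ennreal (exp (- l * (x / c))) * (\<Prod>i=1..n. ?R i (hist e (i - 1)) (e i))" for e
  proof (cases "e \<in> E")
    case True
    have "(\<Prod>i=1..n. ?R i (hist e (i - 1)) (e i)) = (\<Prod>i=1..n. ennreal (exp (l * (s * mart_diff i (hist e (i - 1)) (e i) / c))))"
      using True by (intro prod.cong) (auto simp: E_def)
    also have "\<dots> = ennreal (exp (\<Sum>i=1..n. l * (s * mart_diff i (hist e (i - 1)) (e i) / c)))"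
      by (simp add: prod_ennreal exp_sum)
    also have "(\<Sum>i=1..n. l * (s * mart_diff i (hist e (i - 1)) (e i) / c)) = l * (s * centred e / c)"
      using cond_mean_telescope[of n e]
      by (simp add: centred_def sum_distrib_left sum_divide_distrib)
    also have "ennreal (exp (- l * (x / c))) * ennreal (exp (l * (s * centred e / c))) = ennreal (exp (l * ((s * centred e - x) / c)))"
      by (simp add: diff_divide_distrib algebra_simps flip: ennreal_mult exp_add)
    finally show ?thesis using True l c by (simp add: E_def)
  qed simp
  then have "(\<integral>\<^sup>+ e. indicator E e \<partial>?Q) \<le> (\<integral>\<^sup>+ e. ennreal (exp (- l * (x / c))) * (\<Prod>i=1..n. ?R i (hist e (i - 1)) (e i)) \<partial>?Q)"
    by (intro nn_integral_mono)
  also have "\<dots> = ennreal (exp (- l * (x / c))) * (\<integral>\<^sup>+ e. (\<Prod>i=1..n. ?R i (hist e (i - 1)) (e i)) \<partial>?Q)"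
  proof (rule nn_integral_cmult)
    have [measurable]: "(\<lambda>e. mart_diff i (hist e (i - 1)) (e i)) \<in> borel_measurable ?Q" if "i \<in> {1..n}" for i
      using that by (intro mart_diff_measurable) auto
    show "(\<lambda>e. \<Prod>i=1..n. ?R i (hist e (i - 1)) (e i)) \<in> borel_measurable ?Q" by measurable
  qed
  also have "\<dots> \<le> ennreal (exp (- l * (x / c))) * (\<Prod>i=1..n. ennreal (two_point_mgf l (?t i)))"
    unfolding c_def by (intro mult_left_mono truncated_product_mgf_le s y l) auto
  also have "\<dots> = ennreal (exp (- l * (x / c)) * (\<Prod>i=1..n. two_point_mgf l (?t i)))"
    using t0 by (subst prod_ennreal) (auto intro!: ennreal_mult[symmetric] prod_nonneg)
  finally have "measure ?Q E \<le> exp (- l * (x / c)) * (\<Prod>i=1..n. two_point_mgf l (?t i))"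
    using E t0 unfolding measure_def by (intro enn2real_leI mult_nonneg_nonneg prod_nonneg) auto
  also have "\<dots> \<le> exp (- l * (x / c)) * two_point_mgf l ((\<Sum>i=1..n. ?t i) / card {1..n}) ^ card {1..n}"
    using n l V_pos by (intro mult_left_mono prod_two_point_mgf_le) (auto simp: less_imp_le)
  also have "(\<Sum>i=1..n. ?t i) / card {1..n} = (sqrt ?v / c)\<^sup>2 / n"
    using v by (simp add: power_divide sum_divide_distrib)
  finally show "measure ?Q {e \<in> space ?Q. s * centred e \<ge> x \<and> (\<forall>k\<in>{1..n}. G_fun (P k) (e k) \<le> ennreal y)}
      \<le> exp (- l * (x / c)) * two_point_mgf l ((sqrt ?v / c)\<^sup>2 / n) ^ n"
    by (simp add: E_def)
qed

end

(* A point (x_{m-i})_{i>=1} of X^N is encoded as u :: nat => 'x with u j = x_{m-(j+1)}.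
   Points of X^n are the extensional functions on {1..n}. *)
theorem proposition4p6:
  fixes M :: "'w measure"
    and \<epsilon> :: "nat \<Rightarrow> 'w \<Rightarrow> 'y::polish_space"
    and F :: "nat \<Rightarrow> (nat \<Rightarrow> 'x::polish_space) \<Rightarrow> 'y \<Rightarrow> 'x"
    and X0 :: "int \<Rightarrow> 'x"
    and X :: "int \<Rightarrow> 'w \<Rightarrow> 'x"
    and a V :: "nat \<Rightarrow> real"
    and f :: "(nat \<Rightarrow> 'x) \<Rightarrow> real"
    and n :: nat
    and S :: "'w \<Rightarrow> real"
    and s x y Vtot :: real
  assumes prob: "prob_space M"
    and indep: "prob_space.indep_vars M (\<lambda>_. borel) \<epsilon> {1..}"
    and F_meas: "\<And>m. m \<ge> 1 \<Longrightarrow>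
      (\<lambda>(u, z). F m u z) \<in> borel_measurable ((\<Pi>\<^sub>M j\<in>UNIV. borel) \<Otimes>\<^sub>M borel)"
    and X_init: "\<And>i \<omega>. i \<le> 0 \<Longrightarrow> \<omega> \<in> space M \<Longrightarrow> X i \<omega> = X0 i"
    and X_rec: "\<And>m \<omega>. m \<ge> 1 \<Longrightarrow> \<omega> \<in> space M \<Longrightarrow>
      X (int m) \<omega> = F m (\<lambda>j. X (int m - int (Suc j)) \<omega>) (\<epsilon> m \<omega>)"
    and a_nonneg: "\<And>i. i \<ge> 1 \<Longrightarrow> a i \<ge> 0"
    and a_summable: "summable (\<lambda>j. a (Suc j))"
    and a_sum: "(\<Sum>j. a (Suc j)) < 1"
    and contraction: "\<And>m u u'. m \<ge> 1 \<Longrightarrow>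
      (\<integral>\<^sup>+ \<omega>. ennreal (dist (F m u (\<epsilon> m \<omega>)) (F m u' (\<epsilon> m \<omega>))) \<partial>M)
        \<le> (\<Sum>j. ennreal (a (Suc j) * dist (u j) (u' j)))"
    and n: "n \<ge> 1"
    and f_lipschitz: "\<And>p p'. p \<in> {1..n} \<rightarrow>\<^sub>E UNIV \<Longrightarrow> p' \<in> {1..n} \<rightarrow>\<^sub>E UNIV \<Longrightarrow>
      \<bar>f p - f p'\<bar> \<le> (\<Sum>i=1..n. dist (p i) (p' i))"
    and S_def: "\<And>\<omega>. S \<omega> = f (\<lambda>i\<in>{1..n}. X (int i) \<omega>)
      - integral\<^sup>L M (\<lambda>\<omega>'. f (\<lambda>i\<in>{1..n}. X (int i) \<omega>'))"
    and F_lipschitz: "\<And>m u z z'. m \<ge> 1 \<Longrightarrow> dist (F m u z) (F m u z') \<le> dist z z'"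
    and V_pos: "\<And>k. k \<in> {1..n} \<Longrightarrow> V k > 0"
    and V_bound: "\<And>k. k \<in> {1..n} \<Longrightarrow>
      (\<integral>\<^sup>+ \<omega>. (G_fun (distr M borel (\<epsilon> k)) (\<epsilon> k \<omega>))\<^sup>2 \<partial>M) \<le> ennreal (V k)"
    and Vtot_def: "Vtot = (\<Sum>k=1..n. (diag_coeff a (n - k))\<^sup>2 * V k)"
    and sign: "s \<in> {1, -1}"
    and pos: "x > 0" "y > 0"
  shows "measure M {\<omega> \<in> space M. s * S \<omega> \<ge> x}
    \<le> H_fun n (x / (y * diag_coeff a (n - 1))) (sqrt Vtot / (y * diag_coeff a (n - 1)))
      + measure M {\<omega> \<in> space M. Max ((\<lambda>k. G_fun (distr M borel (\<epsilon> k)) (\<epsilon> k \<omega>)) ` {1..n}) > ennreal y}"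
proof -
  interpret prob_space M by (rule prob)
  have eps_meas: "\<epsilon> m \<in> borel_measurable M" if "m \<ge> 1" for m
    using indep that by (simp add: indep_vars_def)
  \<comment> \<open>Index 0 borrows the law of \<open>\<epsilon> 1\<close>: measurability of
    \<open>\<epsilon> m\<close> is known only for \<open>m \<ge> 1\<close>, while the locale needs a
    probability measure at every index.\<close>
  define P where "P m = distr M borel (\<epsilon> (max m 1))" for m
  have P_eq: "P m = distr M borel (\<epsilon> m)" if "m \<ge> 1" for m
    using that by (simp add: P_def max_absorb1)
  interpret contracting_recursion P F X0 a V f n
  proof (rule contracting_recursion.intro)
    show "prob_space (P m)" for m unfolding P_def by (intro prob_space_distr eps_meas) simp
    fix m :: nat and u u' assume m: "m \<ge> 1"
    have "F m w \<in> borel_measurable borel" for w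
      using F_lipschitz[OF m] by (intro borel_measurable_continuous_onI lipschitz_on_continuous_on[of 1] lipschitz_onI) auto
    then show "(\<integral>\<^sup>+ z. ennreal (dist (F m u z) (F m u' z)) \<partial>P m) \<le> (\<Sum>j. ennreal (a (Suc j) * dist (u j) (u' j)))"
      using contraction[OF m, of u u'] eps_meas[OF m] by (simp add: P_eq[OF m] nn_integral_distr)
  next
    fix k assume k: "k \<in> {1..n}"
    then have k1: "k \<ge> 1" by simp
    interpret Pk: prob_space "distr M borel (\<epsilon> k)" by (intro prob_space_distr eps_meas k1)
    have "G_fun (distr M borel (\<epsilon> k)) \<in> borel_measurable borel"
      unfolding G_fun_def by measurable
    then show "(\<integral>\<^sup>+ z. (G_fun (P k) z)\<^sup>2 \<partial>P k) \<le> ennreal (V k)"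
      using V_bound[OF k] eps_meas[OF k1] by (simp add: P_eq[OF k1] nn_integral_distr)
  qed (fact F_meas a_nonneg f_lipschitz F_lipschitz V_pos | simp add: P_def)+
  \<comment> \<open>By independence the law of \<open>e\<close> is the product measure, so the
    probability can be computed on the product space.\<close>
  define e where "e \<omega> = (\<lambda>i\<in>{1..n}. \<epsilon> i \<omega>)" for \<omega>
  have e_distr: "distr M (\<Pi>\<^sub>M i\<in>{1..n}. borel) e = Pi\<^sub>M {1..n} P"
  proof -
    have "indep_vars (\<lambda>_. borel) \<epsilon> {1..n}" by (rule indep_vars_subset[OF indep]) auto
    then have "distr M (\<Pi>\<^sub>M i\<in>{1..n}. borel) e = (\<Pi>\<^sub>M i\<in>{1..n}. distr M borel (\<epsilon> i))"
      using n eps_meas unfolding e_def by (subst (asm) indep_vars_iff_distr_eq_PiM') auto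
    also have "\<dots> = Pi\<^sub>M {1..n} P" by (intro PiM_cong) (auto simp: P_eq)
    finally show ?thesis .
  qed
  have sets_eq: "sets (\<Pi>\<^sub>M i\<in>{1..n}. borel) = sets (Pi\<^sub>M {1..n} P)" by (intro sets_PiM_cong) auto
  have e_meas0: "e \<in> M \<rightarrow>\<^sub>M (\<Pi>\<^sub>M i\<in>{1..n}. borel)"
    unfolding e_def by (intro measurable_restrict eps_meas) auto
  then have e_meas [measurable]: "e \<in> M \<rightarrow>\<^sub>M Pi\<^sub>M {1..n} P"
    using sets_eq by (simp cong: measurable_cong_sets)
  have e_distr': "distr M (Pi\<^sub>M {1..n} P) e = Pi\<^sub>M {1..n} P"
    using e_distr sets_eq by (simp cong: distr_cong)
  \<comment> \<open>The claim covers all \<open>i \<le> k\<close>, negative ones included, because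
    \<open>F\<close> reads the entire past.\<close>
  have X_hist: "X i \<omega> = hist (e \<omega>) k i" if "\<omega> \<in> space M" "k \<le> n" "i \<le> int k" for \<omega> k i
    using that(2,3)
  proof (induction k arbitrary: i)
    case 0
    then show ?case using X_init that(1) by simp
  next
    case (Suc k)
    show ?case
    proof (cases "i = int (Suc k)")
      case True
      have "past (hist (e \<omega>) k) (Suc k) = (\<lambda>j. X (int (Suc k) - int (Suc j)) \<omega>)"
        using Suc.prems unfolding past_def by (intro ext Suc.IH[symmetric]) auto
      moreover have "e \<omega> (Suc k) = \<epsilon> (Suc k) \<omega>" using Suc.prems by (simp add: e_def)
      ultimately show ?thesis using X_rec[of "Suc k" \<omega>] that(1) True by (simp add: step_def)
    next
      case False
      then show ?thesis using Suc by (simp add: step_def)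
    qed
  qed
  have f_X: "f (\<lambda>i\<in>{1..n}. X (int i) \<omega>) = cond_mean 0 (hist (e \<omega>) n)" if "\<omega> \<in> space M" for \<omega>
    using X_hist[OF that, of n] by (auto intro!: arg_cong[of _ _ f] simp: fun_eq_iff)
  have "(\<integral>\<omega>. f (\<lambda>i\<in>{1..n}. X (int i) \<omega>) \<partial>M) = (\<integral>\<omega>. cond_mean 0 (hist (e \<omega>) n) \<partial>M)"
    by (intro Bochner_Integration.integral_cong refl f_X)
  also have "\<dots> = (\<integral>q. cond_mean 0 (hist q n) \<partial>distr M (Pi\<^sub>M {1..n} P) e)"
    by (rule integral_distr[symmetric, OF e_meas]) (intro cond_mean_hist_measurable, auto)
  also have "\<dots> = cond_mean n X0"
    unfolding e_distr' using cond_mean_hist_integral[of n] by simp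
  finally have S_eq: "S \<omega> = centred (e \<omega>)" if "\<omega> \<in> space M" for \<omega>
    using S_def[of \<omega>] f_X[OF that] by (simp add: centred_def)
  let ?E = "{q \<in> space (Pi\<^sub>M {1..n} P). s * centred q \<ge> x \<and> (\<forall>k\<in>{1..n}. G_fun (P k) (q k) \<le> ennreal y)}"
  let ?A = "e -` ?E \<inter> space M"
  let ?B = "{\<omega> \<in> space M. Max ((\<lambda>k. G_fun (distr M borel (\<epsilon> k)) (\<epsilon> k \<omega>)) ` {1..n}) > ennreal y}"
  have [measurable]: "(\<lambda>q. q i) \<in> borel_measurable (Pi\<^sub>M {1..n} P)" if "i \<in> {1..n}" for i
    using measurable_component_singleton[OF that, of P] by (simp cong: measurable_cong_sets)
  have E: "?E \<in> sets (Pi\<^sub>M {1..n} P)" by measurable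
  have A: "?A \<in> sets M" using E by (rule measurable_sets[OF e_meas])
  have B_eq: "?B = {\<omega> \<in> space M. \<exists>k\<in>{1..n}. G_fun (P k) (e \<omega> k) > ennreal y}"
    using n by (subst Max_gr_iff) (auto simp: e_def P_eq)
  have "(\<lambda>\<omega>. e \<omega> k) \<in> borel_measurable M" if "k \<in> {1..n}" for k
    using that eps_meas by (simp add: e_def)
  then have B: "?B \<in> sets M" unfolding B_eq by measurable
  \<comment> \<open>Either all values of \<open>G_fun\<close> are at most \<open>y\<close>, which is
    the truncated event, or their maximum exceeds \<open>y\<close>.\<close>
  have "measure M {\<omega> \<in> space M. s * S \<omega> \<ge> x} \<le> measure M (?A \<union> ?B)"
  proof (rule finite_measure_mono)
    show "{\<omega> \<in> space M. s * S \<omega> \<ge> x} \<subseteq> ?A \<union> ?B"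
      unfolding B_eq using measurable_space[OF e_meas] by (auto simp: S_eq not_less)
  qed (use A B in auto)
  also have "\<dots> \<le> measure M ?A + measure M ?B"
    by (rule measure_Un_le[OF A B])
  also have "measure M ?A = measure (Pi\<^sub>M {1..n} P) ?E"
    by (subst (2) e_distr'[symmetric]) (rule measure_distr[symmetric, OF e_meas E])
  also have "\<dots> \<le> H_fun n (x / (y * diag_coeff a (n - 1))) (sqrt Vtot / (y * diag_coeff a (n - 1)))"
    unfolding Vtot_def by (rule truncated_tail_le[OF n sign pos(2,1)])
  finally show ?thesis by simp
qed

end
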